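(* Let $A,B\in\mathbb{Q}$ with $AB\neq 0$. The trinomial $x^5+Ax+B$ has reducibility type $(1,2,2)$ if and only if, up to scaling, $$A=\frac{(v^2-v-1)(v^4-2v^3+4v^2-3v+1)}{(2v-1)^2},\qquad B=-\frac{v(v-1)(v^2+1)(v^2-2v+2)}{(2v-1)^2}$$ for some $v\in\mathbb{Q}$ with $v\neq 0,1,\tfrac12$. Moreover, there are no trinomials $x^5+Ax+B$ with $A,B\in\mathbb{Q}$, $AB\neq0$, of reducibility type $(1,1,1,2)$.
   Context: A monic polynomial in $\mathbb{Q}[x]$ has reducibility type $(n_1,\dots,n_k)$, $n_1\le\dots\le n_k$, if it factors as a product of $k$ irreducible polynomials in $\mathbb{Q}[x]$ (not necessarily distinct) of degrees $n_1,\dots,n_k$. Trinomials are considered up to scaling: $x^n+Ax^m+B$ and $x^n+A\lambda^{n-m}x^m+B\lambda^n$ are identified for $\lambda\in\mathbb{Q}\setminus\{0\}$; "up to scaling $(A,B)=(A_0,B_0)$" means $(A,B)=(A_0\lambda^{n-m},B_0\lambda^n)$ for some $\lambda\in\mathbb{Q}\setminus\{0\}$. *)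

theory Defs
  imports "HOL-Computational_Algebra.Computational_Algebra"
begin

definition trinomial :: "nat \<Rightarrow> nat \<Rightarrow> rat \<Rightarrow> rat \<Rightarrow> rat poly" where
  "trinomial n m A B = monom 1 n + monom A m + [:B:]"

(* The factors need not be distinct, nor monic. *)
definition has_reducibility_type :: "rat poly \<Rightarrow> nat list \<Rightarrow> bool" where
  "has_reducibility_type p ns \<longleftrightarrow>
     lead_coeff p = 1 \<and> sorted ns \<and>
     (\<exists>fs. p = prod_list fs \<and> (\<forall>f\<in>set fs. irreducible f) \<and> map degree fs = ns)"

(* Substituting x / l for x and multiplying by l ^ n turns trinomial n m A0 B0
   into trinomial n m A B; only meaningful for m < n. *)
definition eq_up_to_scaling :: "nat \<Rightarrow> nat \<Rightarrow> rat \<times> rat \<Rightarrow> rat \<times> rat \<Rightarrow> bool" where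
  "eq_up_to_scaling n m AB AB0 \<longleftrightarrow>
     (\<exists>l. l \<noteq> 0 \<and> AB = (fst AB0 * l ^ (n - m), snd AB0 * l ^ n))"

end

(*
  If r, s, t are rational roots of x^5 + A x + B, the second divided difference gives
  h_3(r, s, t) = 0 for the complete homogeneous symmetric polynomial h_3. Writing this cubic
  curve through its three rational flex tangents a, b, c turns it into
  a b c = 5 e^3, a + b + c = 5 e with e = r + s + t, and e = 0 forces r s t = 0.
  Over the integers e = 0 follows by descent along a 3-isogeny and its dual.
  In a solution with a, b, c coprime, {a, b, c} = {5 u^3, v^3, w^3}, so
  5 u^3 + v^3 + w^3 = 5 u v w. This curve has the conjugate flex tangents
  k = 5 u + 3 (v + w) and alpha = 5 u + 3 (omega v + omega^2 w), with k |alpha|^2 = - 10 u^3;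
  unique factorisation in Z[omega] and a congruence modulo 5 give k = - 10 S^3 and
  alpha = beta^3, and the traces of beta, omega beta, omega^2 beta, shifted by 5 S,
  are three times a solution of the original system with smaller e.

  Hence x^5 + A x + B with A B nonzero never has three rational roots, which excludes type
  (1,1,1,2) and makes both quadratic factors irreducible in the parametrization of type
  (1,2,2). The parameter v is the linear coefficient of a quadratic factor after the
  rational root is scaled to 1.
*)

theory Submission
  imports Defs
begin


section \<open>Eisenstein integers\<close>

definition omega :: complex where
  "omega = Complex (- 1 / 2) (sqrt 3 / 2)"

text \<open>Eisenstein integers stay inside the complex numbers, so that \<open>cnj\<close>,
  \<open>cmod\<close> and division are at hand; \<open>p\<close> and \<open>q\<close> are
  coordinates in the basis \<open>1\<close>, \<open>omega\<close>, with \<open>omega\<close> a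
  primitive cube root of unity.\<close>

definition eis :: "int \<Rightarrow> int \<Rightarrow> complex" where
  "eis p q = of_int p + of_int q * omega"

definition Eis :: "complex set" where
  "Eis = {z. \<exists>p q. z = eis p q}"

text \<open>This is the norm form of \<open>Z[omega]\<close>, the squared modulus of
  \<open>eis p q\<close>, kept as an integer for divisibility arguments.\<close>

definition enorm :: "int \<Rightarrow> int \<Rightarrow> int" where
  "enorm p q = p\<^sup>2 - p * q + q\<^sup>2"

lemma omega_square: "omega * omega = - 1 - omega"
  by (simp add: omega_def complex_eq_iff)

lemma omega_square_left: "omega * (omega * z) = - z - omega * z"
  unfolding mult.assoc[symmetric] omega_square by (simp add: algebra_simps)

lemma omega_cube: "omega ^ 3 = 1"
proof -
  have "omega ^ 3 = omega * (omega * omega)"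
    by (simp add: power3_eq_cube)
  also have "\<dots> = - omega - omega * omega"
    by (simp add: omega_square algebra_simps)
  finally show ?thesis
    by (simp add: omega_square)
qed

lemma Re_eis: "Re (eis p q) = p - q / 2"
  and Im_eis: "Im (eis p q) = q * sqrt 3 / 2"
  by (simp_all add: eis_def omega_def)

lemma eis_eq_iff: "eis p q = eis r s \<longleftrightarrow> p = r \<and> q = s"
  by (auto simp: complex_eq_iff Re_eis Im_eis)

lemma eis_int: "eis n 0 = of_int n"
  by (simp add: eis_def)

lemma eis_add: "eis p q + eis r s = eis (p + r) (q + s)"
  by (simp add: eis_def algebra_simps)

lemma eis_diff: "eis p q - eis r s = eis (p - r) (q - s)"
  by (simp add: eis_def algebra_simps)

lemma eis_mult: "eis p q * eis r s = eis (p * r - q * s) (p * s + q * r - q * s)"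
proof -
  have "eis p q * eis r s
      = of_int (p * r) + of_int (p * s + q * r) * omega + of_int (q * s) * (omega * omega)"
    by (simp add: eis_def algebra_simps)
  then show ?thesis
    by (simp add: omega_square) (simp add: eis_def algebra_simps)
qed

lemma cnj_eis: "cnj (eis p q) = eis (p - q) (- q)"
  by (simp add: complex_eq_iff Re_eis Im_eis)

lemma eis_mult_cnj: "eis p q * cnj (eis p q) = of_int (enorm p q)"
  unfolding cnj_eis eis_mult eis_int[symmetric] eis_eq_iff
  by (simp add: enorm_def power2_eq_square algebra_simps)

lemma enorm_cmod: "of_int (enorm p q) = (cmod (eis p q))\<^sup>2"
proof -
  have "complex_of_real (of_int (enorm p q)) = complex_of_real ((cmod (eis p q))\<^sup>2)"
    unfolding complex_norm_square using eis_mult_cnj[of p q] by simp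
  then show ?thesis
    by (simp only: of_real_eq_iff)
qed

lemma enorm_nonneg: "0 \<le> enorm p q"
proof -
  have "0 \<le> real_of_int (enorm p q)"
    by (simp add: enorm_cmod)
  then show ?thesis
    by simp
qed

lemma eis_in_Eis: "eis p q \<in> Eis"
  by (auto simp: Eis_def)

lemma EisE:
  assumes "a \<in> Eis"
  obtains p q where "a = eis p q"
  using assms by (auto simp: Eis_def)

lemma Eis_closed:
  assumes "a \<in> Eis" "b \<in> Eis"
  shows "a + b \<in> Eis" "a - b \<in> Eis" "a * b \<in> Eis" "cnj a \<in> Eis"
  using assms by (auto elim!: EisE simp: eis_add eis_diff eis_mult cnj_eis eis_in_Eis)

lemma of_int_in_Eis: "of_int n \<in> Eis"
  unfolding Eis_def using eis_int by (metis (mono_tags) mem_Collect_eq)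

lemma one_in_Eis: "1 \<in> Eis"
  using of_int_in_Eis[of 1] by simp

lemma zero_in_Eis: "0 \<in> Eis"
  using of_int_in_Eis[of 0] by simp

lemma Eis_power: "a \<in> Eis \<Longrightarrow> a ^ n \<in> Eis"
  by (induction n) (auto intro: one_in_Eis Eis_closed)

text \<open>Rounding both coordinates leaves an error \<open>r + s * omega\<close> whose squared
  modulus \<open>r^2 - r s + s^2\<close> is at most 3/4. This makes \<open>Eis\<close>
  norm-Euclidean.\<close>

lemma Eis_approx: "\<exists>w\<in>Eis. cmod (z - w) < 1"
proof -
  \<comment> \<open>\<open>x\<close> and \<open>y\<close> are the real coordinates of
    \<open>z\<close> in the basis \<open>1\<close>, \<open>omega\<close>.\<close>
  define y where "y = Im z * 2 / sqrt 3"
  define x where "x = Re z + y / 2"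
  define r where "r = x - round x"
  define s where "s = y - round y"
  have rs: "\<bar>r\<bar> \<le> 1 / 2" "\<bar>s\<bar> \<le> 1 / 2"
    unfolding r_def s_def using of_int_round_abs_le by (metis abs_minus_commute)+
  have "Re (z - eis (round x) (round y)) = r - s / 2"
    by (simp add: Re_eis r_def s_def x_def algebra_simps diff_divide_distrib)
  moreover have "Im (z - eis (round x) (round y)) = s * sqrt 3 / 2"
    by (simp add: Im_eis s_def y_def algebra_simps diff_divide_distrib)
  ultimately have "(cmod (z - eis (round x) (round y)))\<^sup>2 = (r - s / 2)\<^sup>2 + (s * sqrt 3 / 2)\<^sup>2"
    by (simp only: cmod_power2)
  also have "\<dots> = r\<^sup>2 - r * s + s\<^sup>2"
    by (simp add: power2_eq_square algebra_simps)
  also have "\<dots> \<le> 3 / 4"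
  proof -
    have "\<bar>r\<bar>\<^sup>2 \<le> (1 / 2)\<^sup>2" "\<bar>s\<bar>\<^sup>2 \<le> (1 / 2)\<^sup>2"
      using rs by (intro power_mono; simp)+
    moreover have "\<bar>r\<bar> * \<bar>s\<bar> \<le> (1 / 2) * (1 / 2)"
      using rs by (intro mult_mono) auto
    moreover have "- (r * s) \<le> \<bar>r\<bar> * \<bar>s\<bar>"
      by (simp add: abs_mult[symmetric])
    ultimately show ?thesis
      by (simp add: power2_eq_square)
  qed
  finally have "(cmod (z - eis (round x) (round y)))\<^sup>2 < 1\<^sup>2"
    by simp
  then have "cmod (z - eis (round x) (round y)) < 1"
    by (rule power2_less_imp_less) simp
  then show ?thesis
    using eis_in_Eis by blast
qed

text \<open>Euclidean algorithm, by induction on the norm of the second element, with division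
  supplied by \<open>Eis_approx\<close>. Cofactors are explicit because \<open>Eis\<close> is a
  plain set of complex numbers, where divisibility would otherwise mean divisibility in a
  field.\<close>

lemma Eis_bezout:
  assumes "a \<in> Eis" "b \<in> Eis"
  shows "\<exists>d A B s t. d \<in> Eis \<and> A \<in> Eis \<and> B \<in> Eis \<and> s \<in> Eis \<and> t \<in> Eis \<and>
           a = d * A \<and> b = d * B \<and> d = s * a + t * b"
proof -
  have "\<exists>d A B s t. d \<in> Eis \<and> A \<in> Eis \<and> B \<in> Eis \<and> s \<in> Eis \<and> t \<in> Eis \<and>
           a = d * A \<and> eis p q = d * B \<and> d = s * a + t * eis p q"
    if "a \<in> Eis" for a p q
    using that
  proof (induction "nat (enorm p q)" arbitrary: a p q rule: less_induct)
    case less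
    show ?case
    proof (cases "eis p q = 0")
      case True
      then show ?thesis
        using less.prems one_in_Eis zero_in_Eis by (intro exI[of _ a] exI[of _ 1] exI[of _ 0]) auto
    next
      case False
      obtain w where w: "w \<in> Eis" "cmod (a / eis p q - w) < 1"
        using Eis_approx by blast
      obtain p' q' where r: "a - w * eis p q = eis p' q'"
        using EisE[OF Eis_closed(2)[OF less.prems Eis_closed(3)[OF w(1) eis_in_Eis]]] .
      have "cmod (eis p' q') = cmod (a / eis p q - w) * cmod (eis p q)"
        using False by (simp add: r[symmetric] norm_mult[symmetric] left_diff_distrib)
      also have "\<dots> < cmod (eis p q)"
        using w False by simp
      finally have "real_of_int (enorm p' q') < enorm p q"
        unfolding enorm_cmod by (intro power_strict_mono) auto
      then have "nat (enorm p' q') < nat (enorm p q)"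
        using enorm_nonneg[of p' q'] by simp
      from less.hyps[OF this eis_in_Eis, of p q]
      obtain d A B s t where h: "d \<in> Eis" "A \<in> Eis" "B \<in> Eis" "s \<in> Eis" "t \<in> Eis"
        "eis p q = d * A" "eis p' q' = d * B" "d = s * eis p q + t * eis p' q'"
        by blast
      have aw: "a = w * eis p q + eis p' q'"
        using r by (simp add: algebra_simps)
      then have "a = d * (w * A + B)"
        by (simp only: h(6,7)) (simp add: algebra_simps)
      moreover have "s * eis p q + t * eis p' q' = t * a + (s - t * w) * eis p q"
        unfolding aw by (simp add: algebra_simps)
      then have "d = t * a + (s - t * w) * eis p q"
        using h(8) by (rule trans[rotated])
      ultimately show ?thesis
        using h(1-5,6) w(1)
        by (intro exI[of _ d] exI[of _ "w * A + B"] exI[of _ A] exI[of _ t]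
            exI[of _ "s - t * w"] conjI) (assumption | intro Eis_closed)+
    qed
  qed
  with assms show ?thesis
    unfolding Eis_def by blast
qed

text \<open>Completing the square in either variable bounds both coordinates by 1 in absolute value,
  which leaves the six units.\<close>

lemma enorm_1_cases:
  assumes "enorm p q = 1"
  shows "\<exists>j<3. eis p q = omega ^ j \<or> eis p q = - (omega ^ j)"
proof -
  have e: "4 = (2 * p - q)\<^sup>2 + 3 * q\<^sup>2" "4 = (2 * q - p)\<^sup>2 + 3 * p\<^sup>2"
    using assms by (simp_all add: enorm_def power2_eq_square algebra_simps)
  have "q\<^sup>2 < 2\<^sup>2 \<and> p\<^sup>2 < 2\<^sup>2"
    using e zero_le_power2[of "2 * p - q"] zero_le_power2[of "2 * q - p"]
    unfolding power2_eq_square[of 2] by linarith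
  then have "\<bar>q\<bar> < 2" "\<bar>p\<bar> < 2"
    by (metis abs_numeral power2_abs power2_less_imp_less abs_ge_zero zero_le_numeral)+
  then have "p \<in> {- 1, 0, 1}" "q \<in> {- 1, 0, 1}"
    by auto
  then have "(p, q) \<in> {(1, 0), (- 1, 0), (0, 1), (0, - 1), (1, 1), (- 1, - 1)}"
    using assms by (auto simp: enorm_def)
  moreover have "omega ^ 2 = - 1 - omega"
    by (simp add: power2_eq_square omega_square)
  ultimately consider "eis p q = omega ^ 0 \<or> eis p q = - (omega ^ 0)"
    | "eis p q = omega ^ 1 \<or> eis p q = - (omega ^ 1)"
    | "eis p q = omega ^ 2 \<or> eis p q = - (omega ^ 2)"
    by (auto simp: eis_def)
  then show ?thesis
    by (metis less_numeral_extra(1) one_less_numeral_iff pos2 semiring_norm(77) zero_less_numeral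
        numeral_less_iff semiring_norm(78) numeral_3_eq_3 lessI less_SucI numeral_2_eq_2 One_nat_def)
qed


section \<open>Elements of \<open>Z[omega]\<close> whose norm is a cube\<close>

lemma coprime_bezout_cube:
  fixes a b :: "'a :: comm_ring_1"
  assumes "s * a + t * b = 1"
  shows "1 = (s * (s\<^sup>2 * a\<^sup>2 + 3 * s * a * t * b + 3 * t\<^sup>2 * b\<^sup>2)) * a + t ^ 3 * b ^ 3"
proof -
  have "1 = (s * a + t * b) ^ 3"
    by (simp add: assms)
  also have "\<dots> = (s * (s\<^sup>2 * a\<^sup>2 + 3 * s * a * t * b + 3 * t\<^sup>2 * b\<^sup>2)) * a + t ^ 3 * b ^ 3"
    by (simp add: power2_eq_square power3_eq_cube algebra_simps)
  finally show ?thesis .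
qed

text \<open>\<open>1 + 2 * omega\<close> is a square root of -3. By means of it, the ideal generated
  by the element and its conjugate contains \<open>3 * x\<close> and \<open>3 * y\<close>, hence 3;
  it also contains the norm, which is coprime to 3.\<close>

lemma eis_comaximal_cnj:
  assumes "coprime x y" "coprime 3 (enorm x y)"
  shows "\<exists>P\<in>Eis. \<exists>Q\<in>Eis. P * eis x y + Q * cnj (eis x y) = 1"
proof -
  have ey: "(1 + 2 * omega) * (cnj (eis x y) - eis x y) = of_int (3 * y)"
    unfolding cnj_eis by (simp add: eis_def algebra_simps omega_square omega_square_left)
  have ex: "(1 + 2 * omega) * (omega ^ 2 * eis x y - omega * cnj (eis x y)) = of_int (3 * x)"
    unfolding cnj_eis by (simp add: eis_def algebra_simps omega_square omega_square_left power2_eq_square)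
  obtain m n where mn: "m * x + n * y = 1"
    using assms(1) bezout_int[of x y] by (metis coprime_iff_gcd_eq_1)
  obtain k l where kl: "k * 3 + l * enorm x y = 1"
    using assms(2) bezout_int[of 3 "enorm x y"] by (metis coprime_iff_gcd_eq_1)
  define th where "th = 1 + 2 * omega"
  have "th \<in> Eis" "omega \<in> Eis"
    using eis_in_Eis[of 1 2] eis_in_Eis[of 0 1] by (simp_all add: th_def eis_def)
  note cl = Eis_closed Eis_power of_int_in_Eis this eis_in_Eis
  define P where "P = of_int k * th * (of_int m * omega ^ 2 - of_int n)"
  define Q where "Q = of_int k * th * (of_int n - of_int m * omega) + of_int l * eis x y"
  have "P * eis x y + Q * cnj (eis x y)
      = of_int k * (of_int m * (th * (omega ^ 2 * eis x y - omega * cnj (eis x y)))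
          + of_int n * (th * (cnj (eis x y) - eis x y)))
        + of_int l * (eis x y * cnj (eis x y))"
    by (simp add: P_def Q_def algebra_simps)
  also have "\<dots> = of_int (k * (m * (3 * x) + n * (3 * y)) + l * enorm x y)"
    unfolding th_def ex ey eis_mult_cnj by simp
  also have "k * (m * (3 * x) + n * (3 * y)) + l * enorm x y
      = k * 3 * (m * x + n * y) + l * enorm x y"
    by (simp add: algebra_simps)
  also have "\<dots> = 1"
    using kl mn by simp
  finally have "P * eis x y + Q * cnj (eis x y) = 1"
    by simp
  moreover have "P \<in> Eis" "Q \<in> Eis"
    unfolding P_def Q_def by (intro cl)+
  ultimately show ?thesis
    by blast
qed

text \<open>Let \<open>d\<close> be a gcd of \<open>eis x y\<close> and \<open>n\<close>. Since the
  element is comaximal with its conjugate, it is associated to \<open>d ^ 3\<close>.\<close>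

lemma eis_cube_of_norm_cube:
  assumes "coprime x y" "coprime 3 n" "enorm x y = n ^ 3"
  shows "\<exists>p q. \<exists>j<3. eis x y = omega ^ j * eis p q ^ 3"
proof -
  define a where "a = eis x y"
  have a: "a \<in> Eis" "cnj a \<in> Eis"
    by (auto simp: a_def intro: eis_in_Eis Eis_closed)
  have ac: "a * cnj a = of_int n ^ 3"
    by (simp add: a_def eis_mult_cnj assms(3))
  have "n \<noteq> 0"
    using assms(2) by auto
  then have a0: "a \<noteq> 0"
    using ac by auto
  have "coprime 3 (enorm x y)"
    using assms(2) by (simp add: assms(3))
  then obtain P Q where PQ: "P \<in> Eis" "Q \<in> Eis" "P * a + Q * cnj a = 1"
    using eis_comaximal_cnj[OF assms(1)] unfolding a_def by blast
  obtain d A C s t where h: "d \<in> Eis" "A \<in> Eis" "C \<in> Eis" "s \<in> Eis" "t \<in> Eis"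
    "a = d * A" "of_int n = d * C" "d = s * a + t * of_int n"
    using Eis_bezout[OF a(1) of_int_in_Eis] by blast
  have d0: "d \<noteq> 0"
    using h(6) a0 by auto
  have "d * (s * A + t * C) = s * (d * A) + t * (d * C)"
    by (simp add: algebra_simps)
  also have "\<dots> = d"
    unfolding h(6,7)[symmetric] by (rule h(8)[symmetric])
  finally have "d * (s * A + t * C) = d" .
  then have "s * A + t * C = 1"
    using d0 by simp
  \<comment> \<open>Cubing the Bezout identity shows that \<open>A\<close> is comaximal with
    \<open>C ^ 3\<close>.\<close>
  note cub = coprime_bezout_cube[OF this]
  define s' where "s' = s * (s\<^sup>2 * A\<^sup>2 + 3 * s * A * t * C + 3 * t\<^sup>2 * C\<^sup>2)"
  have "3 \<in> Eis"
    using of_int_in_Eis[of 3] by simp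
  then have s': "s' \<in> Eis"
    unfolding s'_def by (intro Eis_closed Eis_power h)
  have "d * (A * cnj a) = d * (d\<^sup>2 * C ^ 3)"
    using ac by (simp add: h(6,7) power2_eq_square power3_eq_cube mult_ac)
  then have Ac: "A * cnj a = d\<^sup>2 * C ^ 3"
    using d0 by simp
  \<comment> \<open>\<open>A\<close> divides \<open>d\<^sup>2 * C ^ 3\<close> and is comaximal with
    \<open>C ^ 3\<close>, so it divides \<open>d\<^sup>2\<close>; \<open>B\<close> is the
    cofactor.\<close>
  define B where "B = s' * d\<^sup>2 + t ^ 3 * cnj a"
  have B: "B \<in> Eis"
    unfolding B_def by (intro Eis_closed Eis_power h s' a)
  have "d\<^sup>2 = d\<^sup>2 * (s' * A + t ^ 3 * C ^ 3)"
    using cub by (simp add: s'_def)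
  also have "\<dots> = A * s' * d\<^sup>2 + t ^ 3 * (A * cnj a)"
    unfolding Ac by (simp add: algebra_simps)
  also have "\<dots> = A * B"
    by (simp add: B_def algebra_simps)
  finally have dB: "d\<^sup>2 = A * B" .
  have A0: "A \<noteq> 0"
    using h(6) a0 by auto
  have cB: "cnj a = B * C ^ 3"
    using Ac A0 by (simp add: dB)
  \<comment> \<open>\<open>B\<close> divides both \<open>a\<^sup>2\<close> and \<open>cnj a\<close>.
    Squaring the comaximality relation of \<open>a\<close> and \<open>cnj a\<close> shows that
    \<open>B\<close> is a unit, with inverse \<open>D\<close> below.\<close>
  have "1 = (P * a + Q * cnj a)\<^sup>2"
    by (simp add: PQ)
  also have "\<dots> = P\<^sup>2 * a\<^sup>2 + (2 * P * Q * a + Q\<^sup>2 * cnj a) * cnj a"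
    by (simp add: power2_eq_square algebra_simps)
  also have "a\<^sup>2 = B * (A * A\<^sup>2)"
    using dB by (simp add: h(6) power_mult_distrib)
  also have "P\<^sup>2 * (B * (A * A\<^sup>2)) + (2 * P * Q * a + Q\<^sup>2 * cnj a) * cnj a
     = B * (P\<^sup>2 * A * A\<^sup>2 + (2 * P * Q * a + Q\<^sup>2 * cnj a) * C ^ 3)"
    by (subst (2) cB) (simp add: algebra_simps)
  finally have BD: "B * (P\<^sup>2 * A * A\<^sup>2 + (2 * P * Q * a + Q\<^sup>2 * cnj a) * C ^ 3) = 1" ..
  define D where "D = P\<^sup>2 * A * A\<^sup>2 + (2 * P * Q * a + Q\<^sup>2 * cnj a) * C ^ 3"
  have "2 \<in> Eis"
    using of_int_in_Eis[of 2] by simp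
  then have D: "D \<in> Eis" "B * D = 1"
    using BD unfolding D_def
    by (simp_all only: Eis_closed(1,3) Eis_power h(1-5) a PQ(1,2))
  have aD: "a = D * d ^ 3"
  proof -
    have "D * d ^ 3 = D * d * d\<^sup>2"
      by (simp add: power2_eq_square power3_eq_cube)
    also have "\<dots> = d * A * (B * D)"
      by (simp add: dB)
    finally show ?thesis
      by (simp add: D h(6))
  qed
  obtain D1 D2 where D12: "D = eis D1 D2"
    using EisE[OF D(1)] .
  obtain B1 B2 where B12: "B = eis B1 B2"
    using EisE[OF B] .
  have "real_of_int (enorm B1 B2 * enorm D1 D2) = (cmod (B * D))\<^sup>2"
    by (simp add: B12 D12 enorm_cmod norm_mult power_mult_distrib)
  also have "\<dots> = real_of_int 1"
    by (simp add: D)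
  finally have "enorm B1 B2 * enorm D1 D2 = 1"
    by (simp only: of_int_eq_iff)
  then have "enorm D1 D2 = 1"
    using enorm_nonneg[of D1 D2] by (auto simp: zmult_eq_1_iff)
  then obtain j where j: "j < 3" "D = omega ^ j \<or> D = - (omega ^ j)"
    using enorm_1_cases D12 by blast
  obtain p q where pq: "d = eis p q"
    using EisE[OF h(1)] .
  \<comment> \<open>A unit is a power of \<open>omega\<close> up to sign, and the sign moves into
    the cube.\<close>
  have "- d = eis (- p) (- q)"
    by (simp add: pq eis_def)
  moreover have "a = omega ^ j * d ^ 3 \<or> a = omega ^ j * (- d) ^ 3"
    using j(2) aD by auto
  ultimately show ?thesis
    using j(1) unfolding a_def pq by metis
qed


section \<open>Descent\<close>

lemma coprime_int_primeI:
  fixes a b :: int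
  assumes "\<And>p. prime p \<Longrightarrow> p dvd a \<Longrightarrow> p dvd b \<Longrightarrow> False"
  shows "coprime a b"
proof (rule ccontr)
  assume "\<not> coprime a b"
  then have "gcd a b \<noteq> 1"
    by (simp add: coprime_iff_gcd_eq_1)
  then have "\<bar>gcd a b\<bar> \<noteq> 1"
    by simp
  then obtain p where "prime p" "p dvd gcd a b"
    using prime_factor_int by blast
  with assms[of p] show False
    by simp
qed

lemma coprime_prime_dvdD:
  fixes a b p :: int
  assumes "coprime a b" "prime p" "p dvd a" "p dvd b"
  shows False
  using assms coprime_common_divisor not_prime_unit by blast

lemma int_cube_inj: "(a :: int) ^ 3 = b ^ 3 \<longleftrightarrow> a = b"
proof
  assume "a ^ 3 = b ^ 3"
  then have "root 3 (of_int a ^ 3) = root 3 (of_int b ^ 3)"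
    by (metis of_int_power)
  then show "a = b"
    by (simp add: odd_real_root_power_cancel)
qed simp

text \<open>Unique factorization is applied to absolute values; the sign is restored because -1 is a
  cube.\<close>

lemma int_cube_factor:
  fixes a b c :: int
  assumes "coprime a b" "a * b = c ^ 3" "c \<noteq> 0"
  shows "\<exists>d. a = d ^ 3"
proof -
  have "nat \<bar>a\<bar> * nat \<bar>b\<bar> = nat \<bar>c\<bar> ^ 3"
    using assms(2) by (simp flip: nat_mult_distrib abs_mult nat_power_eq power_abs)
  then have "is_nth_power 3 (nat \<bar>a\<bar> * nat \<bar>b\<bar>)"
    by simp
  moreover have "coprime (nat \<bar>a\<bar>) (nat \<bar>b\<bar>)"
    using assms(1) by simp
  moreover have "a \<noteq> 0" "b \<noteq> 0"
    using assms(2,3) by auto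
  ultimately have "is_nth_power 3 (nat \<bar>a\<bar>)"
    using is_nth_power_mult_coprime_natD(1)[of "nat \<bar>a\<bar>" "nat \<bar>b\<bar>" 3] by simp
  then obtain d where "nat \<bar>a\<bar> = d ^ 3"
    by (rule is_nth_powerE)
  then have "\<bar>a\<bar> = int d ^ 3"
    by (metis abs_ge_zero int_nat_eq of_nat_power)
  then have "a = int d ^ 3 \<or> a = (- int d) ^ 3"
    by (auto simp: abs_if split: if_splits)
  then show ?thesis
    by blast
qed

lemma eis_cube: "eis p q ^ 3 = eis (p ^ 3 - 3 * p * q\<^sup>2 + q ^ 3) (3 * p\<^sup>2 * q - 3 * p * q\<^sup>2)"
  unfolding power3_eq_cube eis_mult eis_eq_iff
  by (simp add: power2_eq_square algebra_simps)

lemma eis_omega: "omega * eis p q = eis (- q) (p - q)"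
  using eis_mult[of 0 1 p q] by (simp add: eis_def)

lemma enorm_eis_cube:
  assumes "j < 3" "eis x y = omega ^ j * eis p q ^ 3"
  shows "enorm x y = enorm p q ^ 3"
proof -
  have "cmod omega ^ 3 = 1"
    using omega_cube by (metis norm_one norm_power)
  then have "cmod omega = 1"
    by (simp add: power_eq_1_iff power_eq_iff_eq_base[of 3 _ 1, simplified])
  then have "real_of_int (enorm x y) = real_of_int (enorm p q ^ 3)"
    by (simp add: enorm_cmod assms norm_mult norm_power flip: power_mult)
  then show ?thesis
    by (simp only: of_int_eq_iff)
qed

text \<open>
  In the field with 25 elements, \<open>omega\<close> is not a cube, whereas the congruence
  \<open>x + 2 y = 0\<close> modulo 5 makes \<open>eis x y\<close> a rational multiple of the cube \<open>1 + 2 omega\<close>.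
\<close>
lemma eis_cube_mod5:
  assumes "eis x y = omega ^ j * eis p q ^ 3" "j < 3" "5 dvd x + 2 * y" "\<not> (5 dvd x \<and> 5 dvd y)"
  shows "j = 0"
proof (rule ccontr)
  define X where "X = p ^ 3 - 3 * p * q\<^sup>2 + q ^ 3"
  define Y where "Y = 3 * p\<^sup>2 * q - 3 * p * q\<^sup>2"
  assume "j \<noteq> 0"
  with assms(2) consider "j = 1" | "j = 2"
    by linarith
  then have xy: "x = - Y \<and> y = X - Y \<or> x = Y - X \<and> y = - X"
  proof cases
    case 1
    then have "eis x y = omega * eis X Y"
      using assms(1) by (simp add: eis_cube X_def Y_def)
    then show ?thesis
      by (simp add: eis_omega eis_eq_iff)
  next
    case 2
    then have "eis x y = omega * (omega * eis X Y)"
      using assms(1) by (simp add: eis_cube X_def Y_def power2_eq_square)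
    then show ?thesis
      by (simp add: eis_omega eis_eq_iff)
  qed
  \<comment> \<open>In terms of the coordinates \<open>X\<close>, \<open>Y\<close> of the cube, the
    congruence \<open>x + 2 * y = 0\<close> modulo 5 becomes \<open>X + Y = 0\<close> for
    \<open>j = 1\<close> and \<open>2 * X + Y = 0\<close> for \<open>j = 2\<close>.\<close>
  then have "X + Y = 3 * (x + 2 * y) - 5 * (X - 2 * Y) \<or> 2 * X + Y = x + 2 * y + 5 * X"
    by auto
  then have D: "5 dvd X + Y \<or> 5 dvd 2 * X + Y"
    using assms(3) by (metis dvd_add dvd_diff dvd_mult dvd_triv_left)
  \<comment> \<open>A check of all 25 residue pairs: either congruence forces both \<open>p\<close>
    and \<open>q\<close> to vanish modulo 5.\<close>
  define P Q where "P = p mod 5" and "Q = q mod 5"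
  have "0 \<le> P" "P < 5" "0 \<le> Q" "Q < 5"
    by (simp_all add: P_def Q_def)
  then have "P \<in> {0, 1, 2, 3, 4}" "Q \<in> {0, 1, 2, 3, 4}"
    by auto
  moreover have "(X + Y) mod 5 = (P ^ 3 - 3 * P * Q\<^sup>2 + Q ^ 3 + (3 * P\<^sup>2 * Q - 3 * P * Q\<^sup>2)) mod 5"
    "(2 * X + Y) mod 5
      = (2 * (P ^ 3 - 3 * P * Q\<^sup>2 + Q ^ 3) + (3 * P\<^sup>2 * Q - 3 * P * Q\<^sup>2)) mod 5"
    unfolding X_def Y_def P_def Q_def power2_eq_square power3_eq_cube
    by (intro mod_add_cong mod_diff_cong mod_mult_cong; simp)+
  ultimately have "P = 0 \<and> Q = 0"
    using D unfolding dvd_eq_mod_eq_0 by auto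
  then have "5 dvd p" "5 dvd q"
    by (auto simp: P_def Q_def)
  then obtain p' q' where "p = 5 * p'" "q = 5 * q'"
    by blast
  then have "5 dvd X" "5 dvd Y"
    by (simp_all add: X_def Y_def power2_eq_square power3_eq_cube)
  with xy show False
    using assms(4) by auto
qed

text \<open>Cancelling 10 leaves coprime factors \<open>k div 10\<close> and
  \<open>enorm x y\<close> with product \<open>(- u) ^ 3\<close>, so both are cubes;
  \<open>eis_cube_of_norm_cube\<close> then passes from the norm to the element.\<close>

lemma norm_times_cube:
  assumes "k * enorm x y = - 10 * u ^ 3" "u \<noteq> 0" "coprime x y" "10 dvd k"
    "coprime (k div 10) (enorm x y)" "\<not> 3 dvd enorm x y"
  shows "\<exists>p q S. \<exists>j<3. k = - 10 * S ^ 3 \<and> eis x y = omega ^ j * eis p q ^ 3 \<and> u = S * enorm p q"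
proof -
  obtain k' where k: "k = 10 * k'"
    using assms(4) by blast
  have kN: "k' * enorm x y = (- u) ^ 3"
    using assms(1) k by simp
  have cop: "coprime k' (enorm x y)"
    using assms(5) k by simp
  obtain S where S: "k' = S ^ 3"
    using int_cube_factor[OF cop kN] assms(2) by auto
  obtain n where n: "enorm x y = n ^ 3"
    using int_cube_factor[of "enorm x y" k' "- u"] cop kN assms(2) by (auto simp: ac_simps)
  have "prime (3 :: int)"
    by simp
  then have "coprime 3 n"
    using assms(6) unfolding n by (metis dvd_power_iff prime_imp_coprime prime_dvd_power_iff zero_less_numeral)
  then obtain p q j where pq: "j < 3" "eis x y = omega ^ j * eis p q ^ 3"
    using eis_cube_of_norm_cube[OF assms(3) _ n] by blast
  have "(- u) ^ 3 = (S * enorm p q) ^ 3"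
    unfolding kN[symmetric] enorm_eis_cube[OF pq] S by (simp add: power_mult_distrib)
  then have "u = (- S) * enorm p q"
    unfolding int_cube_inj by simp
  moreover have "k = - 10 * (- S) ^ 3"
    by (simp add: k S)
  ultimately show ?thesis
    using pq by blast
qed


text \<open>The reason is that 10 is squarefree.\<close>

lemma prime_square_dvd_10_cube:
  fixes p u :: int
  assumes "prime p" "p\<^sup>2 dvd 10 * u ^ 3"
  shows "p dvd u"
proof (rule ccontr)
  assume "\<not> p dvd u"
  then have "coprime (p\<^sup>2) (u ^ 3)"
    using assms(1) by (simp add: prime_imp_coprime)
  then have d: "p\<^sup>2 dvd 10"
    using assms(2) by (simp add: coprime_dvd_mult_left_iff)
  then have "p * p \<le> 10"
    by (intro zdvd_imp_le) (simp_all add: power2_eq_square)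
  moreover have "2 \<le> p"
    using assms(1) by (rule prime_ge_2_int)
  ultimately have "p < 4"
    using mult_mono[of 4 p 4 p] by linarith
  then have "p = 2 \<or> p = 3"
    using \<open>2 \<le> p\<close> by linarith
  then show False
    using d by auto
qed

text \<open>The norm is a quadratic form, so the square of \<open>p\<close> divides
  \<open>10 * u ^ 3\<close>. This serves to prove coordinates coprime.\<close>

lemma prime_dvd_of_dvd_components:
  assumes "k * enorm x y = - 10 * u ^ 3" "prime p" "p dvd x" "p dvd y"
  shows "p dvd u"
proof -
  have "p\<^sup>2 dvd enorm x y"
    unfolding enorm_def power2_eq_square using assms(3,4) by (intro dvd_add dvd_diff mult_dvd_mono)
  then have "p\<^sup>2 dvd - (k * enorm x y)"
    by simp
  then have "p\<^sup>2 dvd 10 * u ^ 3"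
    unfolding assms(1) by simp
  then show ?thesis
    using assms(2) prime_square_dvd_10_cube by blast
qed

lemma prime_dvd_of_common_factor:
  assumes "k * enorm x y = - 10 * u ^ 3" "10 dvd k" "prime p" "p dvd k div 10" "p dvd enorm x y"
  shows "p dvd u" "p dvd k"
proof -
  obtain k' where k: "k = 10 * k'"
    using assms(2) by blast
  have "k' * enorm x y = - (u ^ 3)"
    using assms(1) k by simp
  then have "p dvd - (u ^ 3)"
    using assms(5) by (metis dvd_mult)
  then show "p dvd u"
    using assms(3) by (simp add: prime_dvd_power_iff)
  show "p dvd k"
    using assms(4) k by simp
qed

text \<open>Cubing permutes the residues modulo 5 and commutes with negation.\<close>

lemma five_dvd_cube_sum:
  fixes v w :: int
  assumes "5 dvd v ^ 3 + w ^ 3"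
  shows "5 dvd v + w"
proof -
  define P Q where "P = v mod 5" and "Q = w mod 5"
  have "0 \<le> P" "P < 5" "0 \<le> Q" "Q < 5"
    by (simp_all add: P_def Q_def)
  then have "P \<in> {0, 1, 2, 3, 4}" "Q \<in> {0, 1, 2, 3, 4}"
    by auto
  moreover have "(v ^ 3 + w ^ 3) mod 5 = (P ^ 3 + Q ^ 3) mod 5"
    unfolding P_def Q_def power3_eq_cube
    by (intro mod_add_cong mod_mult_cong; simp)
  moreover have "(v + w) mod 5 = (P + Q) mod 5"
    unfolding P_def Q_def by (intro mod_add_cong; simp)
  ultimately show ?thesis
    using assms unfolding dvd_eq_mod_eq_0 by auto
qed

text \<open>Every integer is congruent to its cube modulo 3.\<close>

lemma three_dvd_cube_sum:
  fixes v w :: int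
  assumes "3 dvd v ^ 3 + w ^ 3"
  shows "3 dvd v + w"
proof -
  define P Q where "P = v mod 3" and "Q = w mod 3"
  have "0 \<le> P" "P < 3" "0 \<le> Q" "Q < 3"
    by (simp_all add: P_def Q_def)
  then have "P \<in> {0, 1, 2}" "Q \<in> {0, 1, 2}"
    by auto
  moreover have "(v ^ 3 + w ^ 3) mod 3 = (P ^ 3 + Q ^ 3) mod 3"
    unfolding P_def Q_def power3_eq_cube
    by (intro mod_add_cong mod_mult_cong; simp)
  moreover have "(v + w) mod 3 = (P + Q) mod 3"
    unfolding P_def Q_def by (intro mod_add_cong; simp)
  ultimately show ?thesis
    using assms unfolding dvd_eq_mod_eq_0 by auto
qed

section \<open>The cubic curve \<open>5 u^3 + v^3 + w^3 = 5 u v w\<close>\<close>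

context
  fixes u v w :: int
  assumes eq: "5 * u ^ 3 + v ^ 3 + w ^ 3 = 5 * u * v * w"
    and cop: "coprime u v" "coprime u w" "coprime v w"
    and u0: "u \<noteq> 0"
begin

text \<open>
  \<open>5 u + 3 (v + w)\<close> and \<open>eis (5 u - 3 w) (3 (v - w)) = 5 u + 3 omega v + 3 omega^2 w\<close>
  are the tangents of the cubic at its flexes with \<open>u = 0\<close>.
\<close>
lemma five_dvd_sum: "5 dvd v + w"
proof -
  have "v ^ 3 + w ^ 3 = 5 * (u * v * w - u ^ 3)"
    using eq by (simp add: algebra_simps)
  then show ?thesis
    using five_dvd_cube_sum by (metis dvd_triv_left)
qed

text \<open>The product of the three tangents is \<open>X^3 + Y^3 + Z^3 - 3 X Y Z\<close> at
  \<open>X = 5 u\<close>, \<open>Y = 3 v\<close>, \<open>Z = 3 w\<close>; adding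
  \<open>10 u^3\<close> gives 27 times the equation of the curve.\<close>

lemma tangent_norm:
  "(5 * u + 3 * (v + w)) * enorm (5 * u - 3 * w) (3 * (v - w)) = - 10 * u ^ 3"
proof -
  have "(5 * u + 3 * (v + w)) * enorm (5 * u - 3 * w) (3 * (v - w)) + 10 * u ^ 3
      = 27 * (5 * u ^ 3 + v ^ 3 + w ^ 3 - 5 * u * v * w)"
    by (simp add: enorm_def power2_eq_square power3_eq_cube algebra_simps)
  then show ?thesis
    by (simp add: eq)
qed

lemma ten_dvd_tangent: "10 dvd 5 * u + 3 * (v + w)"
proof -
  have "even (5 * u + 3 * (v + w))"
  proof (rule ccontr)
    assume odd_k: "odd (5 * u + 3 * (v + w))"
    \<comment> \<open>Modulo 2 the equation reads \<open>u + v + w = u v w\<close>, so an odd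
      tangent makes all three variables odd. Both coordinates of the conjugate tangent are then
      even, which forces \<open>u\<close> to be even.\<close>
    have "even (5 * u ^ 3 + v ^ 3 + w ^ 3) \<longleftrightarrow> even (5 * u * v * w)"
      by (simp add: eq)
    with odd_k have odds: "odd u" "odd v" "odd w"
      by auto
    then have "2 dvd 5 * u - 3 * w" "2 dvd 3 * (v - w)"
      by auto
    with prime_dvd_of_dvd_components[OF tangent_norm, of 2] odds show False
      by auto
  qed
  moreover have "5 dvd 5 * u + 3 * (v + w)"
    by (rule dvd_add[OF dvd_triv_left dvd_mult[OF five_dvd_sum]])
  ultimately show ?thesis
    by presburger
qed

text \<open>Both parts follow from \<open>v = - w\<close> modulo 5; they are the hypotheses of
  \<open>eis_cube_mod5\<close>.\<close>

lemma tangent_mod5: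
  "5 dvd (5 * u - 3 * w) + 2 * (3 * (v - w))"
  "\<not> (5 dvd 5 * u - 3 * w \<and> 5 dvd 3 * (v - w))"
proof -
  obtain m where m: "v + w = 5 * m"
    using five_dvd_sum by blast
  then have v: "v = 5 * m - w"
    by simp
  have "(5 * u - 3 * w) + 2 * (3 * (v - w)) = 5 * (u + 6 * m - 3 * w)"
    by (simp add: v)
  then show "5 dvd (5 * u - 3 * w) + 2 * (3 * (v - w))"
    by (metis dvd_triv_left)
  show "\<not> (5 dvd 5 * u - 3 * w \<and> 5 dvd 3 * (v - w))"
  proof
    assume "5 dvd 5 * u - 3 * w \<and> 5 dvd 3 * (v - w)"
    then have "5 dvd w"
      by presburger
    moreover from this have "5 dvd v"
      unfolding v by simp
    ultimately show False
      using cop(3) coprime_prime_dvdD[of v w 5] by simp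
  qed
qed

text \<open>A prime violating one of the coprimality conditions divides \<open>u\<close>, so it is
  not 3; it then divides \<open>w\<close> too, against the coprimality of \<open>u\<close> and
  \<open>w\<close>.\<close>

lemma tangent_cube_not3:
  assumes u3: "\<not> 3 dvd u"
  shows "\<exists>p q S. \<exists>j<3. 5 * u + 3 * (v + w) = - 10 * S ^ 3 \<and>
           eis (5 * u - 3 * w) (3 * (v - w)) = omega ^ j * eis p q ^ 3 \<and> u = S * enorm p q"
proof (rule norm_times_cube[OF tangent_norm u0 _ ten_dvd_tangent])
  have p3: "p \<noteq> 3" if "p dvd u" for p
    using that u3 by auto
  have p3': "p dvd z" if "prime p" "p dvd u" "p dvd 3 * z" for p z
  proof -
    have "\<not> p dvd 3"
      using p3[OF that(2)] that(1) primes_dvd_imp_eq[of p 3] by auto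
    with that show ?thesis
      by (auto simp: prime_dvd_mult_iff)
  qed
  show "coprime (5 * u - 3 * w) (3 * (v - w))"
  proof (rule coprime_int_primeI)
    fix p assume p: "prime p" "p dvd 5 * u - 3 * w" "p dvd 3 * (v - w)"
    have pu: "p dvd u"
      using prime_dvd_of_dvd_components[OF tangent_norm p] .
    have "p dvd 5 * u - (5 * u - 3 * w)"
      by (rule dvd_diff[OF dvd_mult[OF pu] p(2)])
    then have "p dvd 3 * w"
      by simp
    then have "p dvd w"
      by (rule p3'[OF p(1) pu])
    then show False
      using coprime_prime_dvdD[OF cop(2) p(1) pu] by simp
  qed
  \<comment> \<open>Modulo \<open>u\<close> and \<open>v + w\<close> the norm reduces to
    \<open>27 * w\<^sup>2\<close>.\<close>
  have N: "enorm (5 * u - 3 * w) (3 * (v - w))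
      = u * (25 * u - 15 * (v + w)) + (v + w) * (9 * (v + w) - 27 * w) + 3 * (9 * w\<^sup>2)"
    by (simp add: enorm_def power2_eq_square algebra_simps)
  show "coprime ((5 * u + 3 * (v + w)) div 10) (enorm (5 * u - 3 * w) (3 * (v - w)))"
  proof (rule coprime_int_primeI)
    fix p assume p: "prime p" "p dvd (5 * u + 3 * (v + w)) div 10"
      "p dvd enorm (5 * u - 3 * w) (3 * (v - w))"
    note pu = prime_dvd_of_common_factor[OF tangent_norm ten_dvd_tangent p]
    have "p dvd (5 * u + 3 * (v + w)) - 5 * u"
      by (rule dvd_diff[OF pu(2) dvd_mult[OF pu(1)]])
    then have "p dvd 3 * (v + w)"
      by simp
    then have "p dvd v + w"
      by (rule p3'[OF p(1) pu(1)])
    then have "p dvd 3 * (9 * w\<^sup>2)"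
      using p(3) pu(1) unfolding N by (meson dvd_add_right_iff dvd_add dvd_mult2)
    then have "p dvd 3 * (3 * w\<^sup>2)"
      using p3'[OF p(1) pu(1), of "3 * (3 * w\<^sup>2)"] by simp
    then have "p dvd w\<^sup>2"
      by (rule p3'[OF p(1) pu(1), OF p3'[OF p(1) pu(1)]])
    then have "p dvd w"
      using p(1) prime_dvd_power by blast
    then show False
      using coprime_prime_dvdD[OF cop(2) p(1) pu(1)] by simp
  qed
  show "\<not> 3 dvd enorm (5 * u - 3 * w) (3 * (v - w))"
  proof
    assume "3 dvd enorm (5 * u - 3 * w) (3 * (v - w))"
    moreover have "enorm (5 * u - 3 * w) (3 * (v - w))
      = 25 * u\<^sup>2 + 3 * (- 5 * u * (v + w) + 3 * (v + w)\<^sup>2 - 9 * w * (v + w) + 9 * w\<^sup>2)"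
      by (simp add: enorm_def power2_eq_square algebra_simps)
    ultimately have "3 dvd 25 * u\<^sup>2"
      by (metis dvd_add_left_iff dvd_triv_left)
    then have "3 dvd u\<^sup>2"
      by presburger
    then show False
      using u3 prime_dvd_power[of 3 u 2] by simp
  qed
qed

text \<open>Here \<open>eis 1 2\<close> is a square root of -3, whose cube divides the tangent form.\<close>
lemma tangent_cube_3:
  assumes u3: "3 dvd u"
  shows "\<exists>p q S. \<exists>j<3. 5 * u + 3 * (v + w) = - 10 * S ^ 3 \<and>
           eis (5 * u - 3 * w) (3 * (v - w)) = omega ^ j * eis p q ^ 3 \<and> u = S * enorm p q"
proof -
  have w3: "\<not> 3 dvd w"
    using u3 cop(2) coprime_prime_dvdD[of u w 3] by auto
  obtain u' where u': "u = 3 * u'"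
    using u3 by blast
  have "v ^ 3 + w ^ 3 = 3 * (5 * u' * v * w - 5 * 9 * u' ^ 3)"
    using eq by (simp add: u' algebra_simps)
  then obtain t where t: "v + w = 3 * t"
    using three_dvd_cube_sum by (metis dvdE dvd_triv_left)
  have v: "v = 3 * t - w"
    using t by simp
  \<comment> \<open>Substituting \<open>v = 3 * t - w\<close> into the equation improves
    \<open>3 dvd u\<close> to \<open>9 dvd u\<close>.\<close>
  have "15 * u' * w\<^sup>2 = 9 * (5 * u' * t * w - 15 * u' ^ 3 - 3 * t ^ 3 + 3 * t\<^sup>2 * w - t * w\<^sup>2)"
    using eq unfolding v u' by (simp add: power2_eq_square power3_eq_cube algebra_simps)
  then have "5 * (u' * w\<^sup>2) = 3 * (5 * u' * t * w - 15 * u' ^ 3 - 3 * t ^ 3 + 3 * t\<^sup>2 * w - t * w\<^sup>2)"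
    by simp
  then have "3 dvd u' * w\<^sup>2"
    by presburger
  then have "3 dvd u'"
    using w3 by (simp add: prime_dvd_mult_iff prime_dvd_power_iff)
  then obtain r where u: "u = 9 * r"
    using u' by auto
  \<comment> \<open>\<open>eis x y\<close> is the conjugate tangent divided by the cube of
    \<open>eis 1 2\<close>.\<close>
  define x where "x = w + 5 * r - 2 * t"
  define y where "y = 10 * r - t"
  have eis_xy: "eis (5 * u - 3 * w) (3 * (v - w)) = eis 1 2 ^ 3 * eis x y"
    unfolding eis_cube eis_mult eis_eq_iff by (simp add: u v x_def y_def)
  have N: "enorm (5 * u - 3 * w) (3 * (v - w)) = 27 * enorm x y"
    by (simp add: enorm_def u v x_def y_def power2_eq_square algebra_simps)
  \<comment> \<open>Since 3 does not divide the new norm, the factor 3 on the right goes into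
    \<open>5 * r + t\<close>. What remains, \<open>k * enorm x y = - 10 * r ^ 3\<close>, has the
    shape of \<open>tangent_norm\<close> with \<open>r\<close> in place of \<open>u\<close>.\<close>
  have "(5 * r + t) * enorm x y = - 30 * r ^ 3"
    using tangent_norm unfolding N unfolding u v by (simp add: algebra_simps)
  moreover have x3: "\<not> 3 dvd enorm x y"
  proof
    assume "3 dvd enorm x y"
    moreover have "enorm x y = w\<^sup>2 + 3 * ((5 * r - t) * (2 * w + 3 * (5 * r - t)) - x * y)"
      by (simp add: enorm_def x_def y_def power2_eq_square algebra_simps)
    ultimately have "3 dvd w\<^sup>2"
      by (metis dvd_add_left_iff dvd_triv_left)
    then show False
      using w3 prime_dvd_power[of 3 w 2] by simp
  qed
  moreover from calculation have "3 dvd (5 * r + t) * enorm x y"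
    by simp
  ultimately have "3 dvd 5 * r + t"
    using prime_dvd_mult_iff[of 3 "5 * r + t" "enorm x y"] by simp
  then obtain k where k: "5 * r + t = 3 * k"
    by blast
  have kN: "k * enorm x y = - 10 * r ^ 3"
    using \<open>(5 * r + t) * enorm x y = - 30 * r ^ 3\<close> unfolding k by simp
  have k27: "5 * u + 3 * (v + w) = 27 * k"
    unfolding u t using k by simp
  have k10: "10 dvd k"
    using ten_dvd_tangent unfolding k27 by presburger
  have tk: "t = 3 * k - 5 * r"
    using k by simp
  have dw: False if "prime p" "p dvd r" "p dvd w" for p
    using that coprime_prime_dvdD[OF cop(2) that(1)] by (simp add: u)
  have "r \<noteq> 0"
    using u0 u by simp
  moreover have "coprime x y"
  proof (rule coprime_int_primeI)
    fix p assume p: "prime p" "p dvd x" "p dvd y"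
    have pr: "p dvd r"
      using prime_dvd_of_dvd_components[OF kN p] .
    have "p dvd 10 * r - y"
      using p pr by (intro dvd_diff) auto
    then have pt: "p dvd t"
      by (simp add: y_def)
    have "p dvd x - 5 * r + 2 * t"
      using p pr pt by (intro dvd_diff dvd_add) auto
    then have "p dvd w"
      by (simp add: x_def)
    with dw p pr show False
      by blast
  qed
  moreover have "coprime (k div 10) (enorm x y)"
  proof (rule coprime_int_primeI)
    fix p assume p: "prime p" "p dvd k div 10" "p dvd enorm x y"
    note pr = prime_dvd_of_common_factor[OF kN k10 p]
    have pt: "p dvd t"
      unfolding tk using pr by (intro dvd_diff) auto
    have "enorm x y = w\<^sup>2 + (r * (5 * (2 * w + 5 * r - 2 * t) - 10 * x + 10 * y)
        + t * (x - y - 2 * (2 * w + 5 * r - 2 * t)))"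
      by (simp add: enorm_def x_def y_def power2_eq_square algebra_simps)
    then have "p dvd w\<^sup>2"
      using p(3) pr(1) pt by (metis dvd_add_left_iff dvd_add dvd_mult2)
    then have "p dvd w"
      using p(1) prime_dvd_power by blast
    with dw p pr show False
      by blast
  qed
  ultimately obtain p q S j where h: "j < 3" "k = - 10 * S ^ 3" "eis x y = omega ^ j * eis p q ^ 3"
    "r = S * enorm p q"
    using norm_times_cube[OF kN _ _ k10 _ x3] by blast
  \<comment> \<open>Multiplying the cube root by \<open>eis 1 2\<close>, of norm 3, restores the
    removed cube; correspondingly \<open>S\<close> becomes \<open>3 * S\<close>.\<close>
  define p' q' where "p' = p - 2 * q" and "q' = 2 * p - q"
  have th: "eis p' q' = eis 1 2 * eis p q"
    unfolding eis_mult eis_eq_iff by (simp add: p'_def q'_def)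
  have "enorm p' q' = 3 * enorm p q"
    by (simp add: p'_def q'_def enorm_def power2_eq_square algebra_simps)
  then have "u = (3 * S) * enorm p' q'"
    by (simp add: u h)
  moreover have "5 * u + 3 * (v + w) = - 10 * (3 * S) ^ 3"
    unfolding k27 h(2) by (simp add: power_mult_distrib)
  moreover have "eis (5 * u - 3 * w) (3 * (v - w)) = omega ^ j * eis p' q' ^ 3"
    unfolding eis_xy h(3) th by (simp add: power_mult_distrib)
  ultimately show ?thesis
    using h(1) by blast
qed

text \<open>The congruence modulo 5 removes the unit \<open>omega ^ j\<close>.\<close>

lemma tangent_cube:
  "\<exists>p q S. 5 * u + 3 * (v + w) = - 10 * S ^ 3 \<and>
     eis (5 * u - 3 * w) (3 * (v - w)) = eis p q ^ 3 \<and> u = S * enorm p q"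
proof -
  obtain p q S j where h: "j < 3" "5 * u + 3 * (v + w) = - 10 * S ^ 3"
    "eis (5 * u - 3 * w) (3 * (v - w)) = omega ^ j * eis p q ^ 3" "u = S * enorm p q"
    using tangent_cube_3 tangent_cube_not3 by blast
  have "j = 0"
    using eis_cube_mod5[OF h(3,1) tangent_mod5] .
  with h show ?thesis
    by auto
qed

text \<open>The cube root found in \<open>tangent_cube\<close> leads back to the system
  \<open>a b c = 5 e^3\<close>, \<open>a + b + c = 5 e\<close>. The new parameter \<open>S\<close>
  divides \<open>u\<close>, hence the bound.\<close>

lemma descent_step:
  assumes v0: "v \<noteq> 0" "w \<noteq> 0"
  shows "\<exists>a b c S. a + b + c = 5 * S \<and> a * b * c = 5 * S ^ 3 \<and> S \<noteq> 0 \<and> \<bar>S\<bar> < \<bar>u * v * w\<bar>"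
proof -
  obtain p q S where h: "5 * u + 3 * (v + w) = - 10 * S ^ 3"
     "eis (5 * u - 3 * w) (3 * (v - w)) = eis p q ^ 3" "u = S * enorm p q"
    using tangent_cube by blast
  \<comment> \<open>\<open>2 * p - q\<close>, \<open>- p - q\<close> and \<open>2 * q - p\<close>
    are the traces of \<open>eis p q\<close> and of its products with \<open>omega\<close> and
    \<open>omega^2\<close>; they sum to 0.\<close>
  define a b c where "a = 5 * S + 2 * p - q" and "b = 5 * S - p - q" and "c = 5 * S + 2 * q - p"
  have xy: "5 * u - 3 * w = p ^ 3 - 3 * p * q\<^sup>2 + q ^ 3" "3 * (v - w) = 3 * p\<^sup>2 * q - 3 * p * q\<^sup>2"
    using h(2) unfolding eis_cube eis_eq_iff by auto
  have "a * b * c - 135 * S ^ 3 = - 10 * S ^ 3 + (2 * (p ^ 3 - 3 * p * q\<^sup>2 + q ^ 3)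
      - (3 * p\<^sup>2 * q - 3 * p * q\<^sup>2)) - 15 * (S * enorm p q)"
    by (simp add: a_def b_def c_def enorm_def power2_eq_square power3_eq_cube algebra_simps)
  \<comment> \<open>The three tangents sum to \<open>15 * u\<close>, and
    \<open>u = S * enorm p q\<close>.\<close>
  also have "\<dots> = 0"
    unfolding xy[symmetric] h(3)[symmetric] h(1)[symmetric] by simp
  finally have abc: "a * b * c = 135 * S ^ 3"
    by simp
  have ab: "a = b + 3 * p" "c = b + 3 * q"
    by (simp_all add: a_def b_def c_def)
  \<comment> \<open>\<open>a\<close>, \<open>b\<close>, \<open>c\<close> agree modulo 3 and 3
    divides their product, so 3 divides each of them and can be cancelled.\<close>
  have "3 dvd a * b * c"
    unfolding abc by simp
  then have "3 dvd a \<or> 3 dvd b \<or> 3 dvd c"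
    by (simp add: prime_dvd_mult_iff)
  then have "3 dvd b"
    unfolding ab by presburger
  then obtain b' where b': "b = 3 * b'"
    by blast
  have a': "a = 3 * (b' + p)" and c': "c = 3 * (b' + q)"
    using ab b' by simp_all
  have "(b' + p) * b' * (b' + q) = 5 * S ^ 3"
    using abc unfolding a' b' c' by (simp add: algebra_simps)
  moreover have "a + b + c = 15 * S"
    by (simp add: a_def b_def c_def)
  then have "(b' + p) + b' + (b' + q) = 5 * S"
    unfolding a' b' c' by simp
  moreover have S0: "S \<noteq> 0" "enorm p q \<noteq> 0"
    using u0 h by auto
  moreover have "\<bar>S\<bar> < \<bar>u * v * w\<bar>"
  proof (rule ccontr)
    \<comment> \<open>Without strict decrease, \<open>v\<close> and \<open>w\<close> are 1 or -1.
      Equal signs contradict the equation modulo 5, opposite signs give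
      \<open>u * (u\<^sup>2 + 1) = 0\<close>.\<close>
    assume "\<not> \<bar>S\<bar> < \<bar>u * v * w\<bar>"
    then have "\<bar>S\<bar> * (\<bar>enorm p q\<bar> * \<bar>v * w\<bar>) \<le> \<bar>S\<bar> * 1"
      by (simp add: h(3) abs_mult mult.assoc)
    then have le: "\<bar>enorm p q\<bar> * \<bar>v * w\<bar> \<le> 1"
      using S0 by (subst (asm) mult_le_cancel_left_pos) auto
    have "1 \<le> \<bar>enorm p q\<bar>"
      using S0 by auto
    then have "1 * \<bar>v * w\<bar> \<le> \<bar>enorm p q\<bar> * \<bar>v * w\<bar>"
      by (rule mult_right_mono) simp
    with le have "\<bar>v * w\<bar> \<le> 1"
      by simp
    with v0 have "\<bar>v * w\<bar> = 1"
      by (smt (verit) no_zero_divisors)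
    then have "\<bar>v\<bar> = 1" "\<bar>w\<bar> = 1"
      using zmult_eq_1_iff[of "\<bar>v\<bar>" "\<bar>w\<bar>"] by (auto simp: abs_mult)
    then have "v = 1 \<or> v = - 1" "w = 1 \<or> w = - 1"
      by auto
    then consider "5 * u ^ 3 + 2 = 5 * u" | "5 * u ^ 3 = - 5 * u" | "5 * u ^ 3 - 2 = 5 * u"
      using eq by auto
    then show False
    proof cases
      case 2
      then have "u * (u\<^sup>2 + 1) = 0"
        by (simp add: power2_eq_square power3_eq_cube algebra_simps)
      then show ?thesis
        using u0 by (smt (verit) mult_eq_0_iff zero_le_power2)
    qed presburger+
  qed
  ultimately show ?thesis
    by blast
qed

end

text \<open>Cancelling 5 leaves three pairwise coprime integers whose product is
  \<open>e ^ 3\<close>. Each is a cube, and the cube roots form a point of the curve in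
  \<open>descent_step\<close> with \<open>e = u * v * w\<close>.\<close>

lemma descent_coprime:
  fixes a b c e :: int
  assumes "a + b + c = 5 * e" "a * b * c = 5 * e ^ 3" "e \<noteq> 0"
    and "coprime a b" "coprime a c" "coprime b c" "5 dvd a"
  shows "\<exists>a' b' c' S. a' + b' + c' = 5 * S \<and> a' * b' * c' = 5 * S ^ 3 \<and> S \<noteq> 0 \<and> \<bar>S\<bar> < \<bar>e\<bar>"
proof -
  obtain d where d: "a = 5 * d"
    using assms(7) by blast
  have cop: "coprime d b" "coprime d c" "coprime b c"
    using assms(4,5,6) d by simp_all
  have dbc: "d * b * c = e ^ 3"
    using assms(2) d by simp
  obtain u where u: "d = u ^ 3"
    using int_cube_factor[of d "b * c" e] cop assms(3) dbc by (auto simp: mult_ac)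
  obtain v where v: "b = v ^ 3"
    using int_cube_factor[of b "d * c" e] cop assms(3) dbc by (auto simp: mult_ac coprime_commute)
  obtain w where w: "c = w ^ 3"
    using int_cube_factor[of c "d * b" e] cop assms(3) dbc by (auto simp: mult_ac coprime_commute)
  have "(u * v * w) ^ 3 = e ^ 3"
    using dbc by (simp add: u v w power_mult_distrib)
  then have e: "e = u * v * w"
    by (simp add: int_cube_inj)
  have "5 * u ^ 3 + v ^ 3 + w ^ 3 = 5 * u * v * w"
    using assms(1) by (simp add: d u v w e)
  moreover have "coprime u v" "coprime u w" "coprime v w"
    using cop by (simp_all add: u v w)
  moreover have "u \<noteq> 0" "v \<noteq> 0" "w \<noteq> 0"
    using assms(3) e by auto
  ultimately show ?thesis
    unfolding e by (rule descent_step)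
qed

text \<open>Infinite descent on the absolute value of \<open>e\<close>.\<close>

lemma descent_sum_zero:
  fixes a b c e :: int
  assumes "a + b + c = 5 * e" "a * b * c = 5 * e ^ 3"
  shows "e = 0"
  using assms
proof (induction "nat \<bar>e\<bar>" arbitrary: a b c e rule: less_induct)
  case less
  show ?case
  proof (rule ccontr)
    assume e0: "e \<noteq> 0"
    have step: False if "a' + b' + c' = 5 * S" "a' * b' * c' = 5 * S ^ 3" "S \<noteq> 0" "\<bar>S\<bar> < \<bar>e\<bar>"
      for a' b' c' S
    proof -
      have "nat \<bar>S\<bar> < nat \<bar>e\<bar>"
        using that(4) by simp
      from less.hyps[OF this that(1,2)] that(3) show False
        by simp
    qed
    \<comment> \<open>A prime dividing two of the three numbers divides \<open>e\<close>, because 5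
      is squarefree, and so divides the third; cancelling it gives a smaller solution.\<close>
    have cop: "coprime x y"
      if xyz: "x + y + z = 5 * e" "x * y * z = 5 * e ^ 3" for x y z
    proof (rule coprime_int_primeI)
      fix p assume p: "prime p" "p dvd x" "p dvd y"
      have p2: "p\<^sup>2 dvd 5 * e ^ 3"
        using p(2,3) unfolding xyz(2)[symmetric] power2_eq_square
        by (intro dvd_mult2 mult_dvd_mono)
      have pe: "p dvd e"
      proof (cases "p = 5")
        case True
        then have "5 * 5 dvd 5 * e ^ 3"
          using p2 by (simp only: power2_eq_square)
        then have "5 dvd e ^ 3"
          by (subst (asm) dvd_mult_cancel_left) simp
        then show ?thesis
          using True prime_dvd_power[of 5 e 3] by simp
      next
        case False
        then have "\<not> p dvd 5"
          using p(1) primes_dvd_imp_eq[of p 5] by auto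
        moreover have "p dvd 5 * e ^ 3"
          using p2 by (metis dvd_mult_left power2_eq_square)
        ultimately show ?thesis
          using p(1) prime_dvd_power by (auto simp: prime_dvd_mult_iff)
      qed
      then have "p dvd 5 * e - (x + y)"
        using p by (intro dvd_diff dvd_add) auto
      then have "p dvd z"
        by (simp flip: xyz(1))
      with p pe obtain x' y' z' e' where *: "x = p * x'" "y = p * y'" "z = p * z'" "e = p * e'"
        by (metis dvdE)
      have p1: "1 < p"
        using p(1) prime_gt_1_int by blast
      have "p * (x' + y' + z') = p * (5 * e')"
        using xyz(1) by (simp add: * algebra_simps)
      then have "x' + y' + z' = 5 * e'"
        using p1 by simp
      moreover have "p ^ 3 * (x' * y' * z') = p ^ 3 * (5 * e' ^ 3)"
        using xyz(2) by (simp add: * power3_eq_cube mult_ac)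
      then have "x' * y' * z' = 5 * e' ^ 3"
        using p1 by simp
      moreover have "e' \<noteq> 0"
        using e0 * by auto
      moreover have "1 * \<bar>e'\<bar> < \<bar>p\<bar> * \<bar>e'\<bar>"
        using p1 \<open>e' \<noteq> 0\<close> by (intro mult_strict_right_mono) auto
      then have "\<bar>e'\<bar> < \<bar>e\<bar>"
        by (simp add: * abs_mult)
      ultimately show False
        using step by blast
    qed
    have "5 dvd a * b * c"
      using less.prems(2) by simp
    then consider "5 dvd a" | "5 dvd b" | "5 dvd c"
      by (auto simp: prime_dvd_mult_iff)
    then show False
    proof cases
      case 1
      then show ?thesis
        using descent_coprime[of a b c e] cop[of a b c] cop[of a c b] cop[of b c a] less.prems e0 step
        by (auto simp: ac_simps)
    next
      case 2
      then show ?thesis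
        using descent_coprime[of b a c e] cop[of b a c] cop[of a c b] cop[of b c a] less.prems e0 step
        by (auto simp: ac_simps)
    next
      case 3
      then show ?thesis
        using descent_coprime[of c a b e] cop[of c a b] cop[of a b c] cop[of c b a] less.prems e0 step
        by (auto simp: ac_simps)
    qed
  qed
qed


section \<open>Factorizations of the trinomial\<close>

text \<open>The assumption is the vanishing of the complete homogeneous symmetric polynomial of degree 3.\<close>
lemma rational_roots_product_zero:
  fixes r s t :: rat
  assumes "(r + s + t) ^ 3 - 2 * (r + s + t) * (r * s + s * t + t * r) + r * s * t = 0"
  shows "r * s * t = 0"
proof -
  obtain p1 q1 where 1: "r = of_int p1 / of_int q1" "q1 > 0"
    by (metis quotient_of_div quotient_of_denom_pos surj_pair)
  obtain p2 q2 where 2: "s = of_int p2 / of_int q2" "q2 > 0"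
    by (metis quotient_of_div quotient_of_denom_pos surj_pair)
  obtain p3 q3 where 3: "t = of_int p3 / of_int q3" "q3 > 0"
    by (metis quotient_of_div quotient_of_denom_pos surj_pair)
  \<comment> \<open>The relation is homogeneous, so denominators can be cleared.\<close>
  define D :: rat where "D = of_int (q1 * q2 * q3)"
  define R S T where "R = p1 * q2 * q3" and "S = p2 * q1 * q3" and "T = p3 * q1 * q2"
  have D0: "D \<noteq> 0"
    using 1 2 3 by (simp add: D_def)
  have RST: "of_int R = D * r" "of_int S = D * s" "of_int T = D * t"
    using 1 2 3 by (simp_all add: R_def S_def T_def D_def)
  have "of_int ((R + S + T) ^ 3 - 2 * (R + S + T) * (R * S + S * T + T * R) + R * S * T)
      = D ^ 3 * ((r + s + t) ^ 3 - 2 * (r + s + t) * (r * s + s * t + t * r) + r * s * t)"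
    by (simp add: RST power3_eq_cube algebra_simps)
  also have "\<dots> = of_int 0"
    by (simp only: assms mult_zero_right of_int_0)
  finally have h: "(R + S + T) ^ 3 - 2 * (R + S + T) * (R * S + S * T + T * R) + R * S * T = 0"
    by (simp only: of_int_eq_iff)
  define e where "e = R + S + T"
  \<comment> \<open>The linear forms \<open>2 * e - R\<close>, \<open>2 * e - S\<close>,
    \<open>2 * e - T\<close> are the rational flex tangents of the cubic.\<close>
  have "(2 * e - R) + (2 * e - S) + (2 * e - T) = 5 * e"
    by (simp add: e_def)
  moreover have "(2 * e - R) * (2 * e - S) * (2 * e - T) = 5 * e ^ 3"
  proof -
    have "(2 * e - R) * (2 * e - S) * (2 * e - T) - 5 * e ^ 3
        = - ((R + S + T) ^ 3 - 2 * (R + S + T) * (R * S + S * T + T * R) + R * S * T)"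
      by (simp add: e_def power3_eq_cube algebra_simps)
    then show ?thesis
      unfolding h by simp
  qed
  ultimately have "e = 0"
    by (rule descent_sum_zero)
  then have "R * S * T = 0"
    using h by (simp add: e_def)
  then have "D * r * (D * s) * (D * t) = 0"
    by (metis RST of_int_0 of_int_mult)
  then show ?thesis
    using D0 by simp
qed

section \<open>Linear and quadratic factors\<close>

lemma trinomial_5_1: "trinomial 5 1 A B = [:B, A, 0, 0, 0, 1:]"
  by (simp add: trinomial_def monom_altdef numeral_eq_Suc)

lemma degree_1_monic:
  fixes f :: "'a :: field poly"
  assumes "degree f = 1"
  shows "\<exists>c r. f = smult c [:- r, 1:]"
proof -
  obtain a b where ab: "f = [:a, b:]" "b \<noteq> 0"
    using degree1_coeffs[OF assms] by metis
  then have "f = smult b [:- (- a / b), 1:]"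
    by simp
  then show ?thesis
    by blast
qed

lemma degree_2_monic:
  fixes f :: "'a :: field poly"
  assumes "degree f = 2"
  shows "\<exists>c b a. f = smult c [:b, a, 1:]"
proof -
  obtain a b c where abc: "f = [:c, b, a:]" "a \<noteq> 0"
    using degree2_coeffs[OF assms] by metis
  then have "f = smult a [:c / a, b / a, 1:]"
    by simp
  then show ?thesis
    by blast
qed

text \<open>A proper factor would be linear and so contribute a root.\<close>

lemma irreducible_quadratic:
  fixes a b :: "'a :: field"
  assumes "\<And>x. x\<^sup>2 + a * x + b \<noteq> 0"
  shows "irreducible [:b, a, 1:]"
proof (rule irreducibleI)
  show "\<not> [:b, a, 1:] dvd 1"
    by (simp add: is_unit_iff_degree)
next
  fix f g assume fg: "[:b, a, 1:] = f * g"
  then have nz: "f \<noteq> 0" "g \<noteq> 0"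
    by auto
  have "degree f + degree g = degree [:b, a, 1:]"
    unfolding fg using nz by (simp add: degree_mult_eq)
  then have "degree f + degree g = 2"
    by simp
  moreover have no_linear: "degree h \<noteq> 1" if "h dvd [:b, a, 1:]" for h
  proof
    assume "degree h = 1"
    then obtain c d where h: "h = [:c, d:]" "d \<noteq> 0"
      using degree1_coeffs by metis
    then have "poly h (- c / d) = 0"
      by simp
    then have "poly [:b, a, 1:] (- c / d) = 0"
      using that by (metis dvdE mult_zero_left poly_mult)
    then show False
      using assms[of "- c / d"] by (simp add: power2_eq_square algebra_simps)
  qed
  have "degree f \<noteq> 1" "degree g \<noteq> 1"
    by (intro no_linear; simp add: fg)+
  ultimately have "degree f = 0 \<or> degree g = 0"
    by linarith
  then show "f dvd 1 \<or> g dvd 1"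
    using nz by (simp add: is_unit_iff_degree)
qed simp

lemma three_rational_roots:
  assumes "[:B, A, 0, 0, 0, 1:]
    = smult c ([:- r, 1:] * [:- s, 1:] * [:- t, 1:] * [:b, a, 1 :: rat:])"
  shows "B = 0"
proof -
  have c: "c = 1"
    using assms by simp
  \<comment> \<open>Comparison of coefficients: those of \<open>x^4\<close> and \<open>x^3\<close>
    determine \<open>a\<close> and \<open>b\<close>, and that of \<open>x^2\<close> then becomes the
    cubic relation between the roots.\<close>
  have eqs: "B = - (b * (r * (s * t))) \<and>
      b * r + (b * s + (b * t + r * (s * t))) = a * (r * s) + (a * (r * t) + a * (s * t)) \<and>
      a * r + (a * s + a * t) = b + (r * s + (r * t + s * t)) \<and> r + (s + t) = a"
    using assms unfolding c by (simp add: algebra_simps)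
  then have "(r + s + t) ^ 3 - 2 * (r + s + t) * (r * s + s * t + t * r) + r * s * t = 0"
    by algebra
  then have "r * s * t = 0"
    by (rule rational_roots_product_zero)
  with eqs show ?thesis
    by auto
qed

text \<open>A root \<open>x\<close> splits the quadratic, with second root \<open>- a - x\<close>,
  and gives three rational roots in all.\<close>

lemma quadratic_factor_no_root:
  assumes "[:B, A, 0, 0, 0, 1:] = [:- r, 1:] * [:b, a, 1:] * [:d, e, 1 :: rat:]" "B \<noteq> 0"
  shows "x\<^sup>2 + a * x + b \<noteq> 0"
proof
  assume "x\<^sup>2 + a * x + b = 0"
  then have "b = - x * x - a * x"
    by (simp add: power2_eq_square algebra_simps add_eq_0_iff)
  then have "[:b, a, 1:] = [:- x, 1:] * [:- (- a - x), 1:]"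
    by (simp add: algebra_simps)
  then have "[:B, A, 0, 0, 0, 1:]
      = smult 1 ([:- r, 1:] * [:- x, 1:] * [:- (- a - x), 1:] * [:d, e, 1:])"
    unfolding assms(1) by (simp only: smult_1_left mult.assoc)
  then show False
    using three_rational_roots assms(2) by blast
qed

lemma type_122_imp_parametrization:
  assumes "[:B, A, 0, 0, 0, 1:] = smult k ([:- r, 1:] * [:b, a, 1:] * [:d, e, 1 :: rat:])" "B \<noteq> 0"
  shows "\<exists>v. v \<noteq> 0 \<and> v \<noteq> 1 \<and> v \<noteq> 1 / 2 \<and> r \<noteq> 0 \<and>
     A = (v^2 - v - 1) * (v^4 - 2 * v^3 + 4 * v^2 - 3 * v + 1) / (2 * v - 1)^2 * r ^ 4 \<and>
     B = - (v * (v - 1) * (v^2 + 1) * (v^2 - 2 * v + 2) / (2 * v - 1)^2) * r ^ 5"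
proof -
  have k: "k = 1"
    using assms by simp
  have "smult k ([:- r, 1:] * [:b, a, 1:] * [:d, e, 1:])
      = [:- (r * b * d), b * d - r * (a * d + e * b), (a * d + e * b) - r * (b + d + a * e),
          b + d + a * e - r * (a + e), a + e - r, 1:]"
    unfolding k by (simp add: algebra_simps)
  then have eqs: "a + e = r" "b + d + a * e = r * (a + e)" "a * d + e * b = r * (b + d + a * e)"
    "A = b * d - r * (a * d + e * b)" "B = - (r * b * d)"
    unfolding assms(1)[symmetric] by simp_all
  have r0: "r \<noteq> 0"
    using eqs(5) assms(2) by auto
  define v where "v = a / r"
  have ae: "a = v * r" "e = (1 - v) * r"
    using r0 by (simp_all add: v_def left_diff_distrib flip: eqs(1))
  \<comment> \<open>The coefficients of \<open>x^3\<close> and \<open>x^2\<close> give two linear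
    equations for \<open>b\<close> and \<open>d\<close>, with determinant
    \<open>2 * v - 1\<close>.\<close>
  have bd: "b + d = r\<^sup>2 * (1 - v + v\<^sup>2)"
    using eqs(2) unfolding eqs(1) ae by (simp add: power2_eq_square algebra_simps)
  have "r * (v * d + (1 - v) * b) = r * r\<^sup>2"
    using eqs(3) unfolding eqs(1,2) unfolding ae by (simp add: power2_eq_square algebra_simps)
  then have bd': "v * d + (1 - v) * b = r\<^sup>2"
    using r0 by simp
  have b: "b * (2 * v - 1) = r\<^sup>2 * ((v - 1) * (v\<^sup>2 + 1))"
    using bd bd' by algebra
  have d: "d * (2 * v - 1) = r\<^sup>2 * (v * (v\<^sup>2 - 2 * v + 2))"
    using bd bd' by algebra
  \<comment> \<open>At \<open>v = 1 / 2\<close> the left side of \<open>b\<close> vanishes while its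
    right side does not.\<close>
  have v2: "2 * v - 1 \<noteq> 0"
  proof
    assume "2 * v - 1 = 0"
    then have "v = 1 / 2"
      by simp
    with b r0 show False
      by (simp add: power2_eq_square)
  qed
  have bd2: "b * d * (2 * v - 1)\<^sup>2 = r ^ 4 * (v * (v - 1) * (v\<^sup>2 + 1) * (v\<^sup>2 - 2 * v + 2))"
    using b d by algebra
  have "v \<noteq> 0" "v \<noteq> 1"
    using bd2 assms(2) eqs(5) v2 by auto
  moreover have "v \<noteq> 1 / 2"
    using v2 by auto
  moreover have "A * (2 * v - 1)\<^sup>2 = (v^2 - v - 1) * (v^4 - 2 * v^3 + 4 * v^2 - 3 * v + 1) * r ^ 4"
    using bd2 eqs(1,2,3,4) by algebra
  then have "A = (v^2 - v - 1) * (v^4 - 2 * v^3 + 4 * v^2 - 3 * v + 1) / (2 * v - 1)^2 * r ^ 4"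
    using v2 by (simp add: field_simps)
  moreover have "B * (2 * v - 1)\<^sup>2 = - (v * (v - 1) * (v^2 + 1) * (v^2 - 2 * v + 2)) * r ^ 5"
    using bd2 eqs(5) by algebra
  then have "B = - (v * (v - 1) * (v^2 + 1) * (v^2 - 2 * v + 2) / (2 * v - 1)^2) * r ^ 5"
    using v2 by (simp add: field_simps)
  ultimately show ?thesis
    using r0 by blast
qed

lemma parametrization_factors:
  fixes v l :: rat
  assumes "v \<noteq> 1 / 2"
    "A = (v^2 - v - 1) * (v^4 - 2 * v^3 + 4 * v^2 - 3 * v + 1) / (2 * v - 1)^2 * l ^ 4"
    "B = - (v * (v - 1) * (v^2 + 1) * (v^2 - 2 * v + 2) / (2 * v - 1)^2) * l ^ 5"
  shows "\<exists>b a d e. [:B, A, 0, 0, 0, 1:] = [:- l, 1:] * [:b, a, 1:] * [:d, e, 1:]"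
proof -
  define D where "D = 2 * v - 1"
  have D0: "D \<noteq> 0"
    using assms(1) by (auto simp: D_def field_simps)
  \<comment> \<open>\<open>m\<close> and \<open>n\<close> are the constant terms of the quadratic
    factors when the root is 1, as solved for in
    \<open>type_122_imp_parametrization\<close>.\<close>
  define m n where "m = (v - 1) * (v\<^sup>2 + 1) / D" and "n = v * (v\<^sup>2 - 2 * v + 2) / D"
  have mn: "m * D = (v - 1) * (v\<^sup>2 + 1)" "n * D = v * (v\<^sup>2 - 2 * v + 2)"
    using D0 by (simp_all add: m_def n_def)
  have "D * (m + n + v * (1 - v) - 1) = 0"
    using mn unfolding D_def by algebra
  then have 1: "m + n + v * (1 - v) = 1"
    using D0 by simp
  have "D * (v * n + (1 - v) * m - 1) = 0"
    using mn unfolding D_def by algebra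
  then have 2: "v * n + (1 - v) * m = 1"
    using D0 by simp
  have mn2: "m * n * D\<^sup>2 = v * (v - 1) * (v\<^sup>2 + 1) * (v\<^sup>2 - 2 * v + 2)"
    using mn by algebra
  have "B = - (m * n * D\<^sup>2 / D\<^sup>2) * l ^ 5"
    unfolding mn2 unfolding D_def by (rule assms(3))
  then have B: "B = - (m * n) * l ^ 5"
    using D0 by simp
  have mn1: "(m * n - 1) * D\<^sup>2 = (v^2 - v - 1) * (v^4 - 2 * v^3 + 4 * v^2 - 3 * v + 1)"
    using mn2 unfolding D_def by algebra
  have "A = (m * n - 1) * D\<^sup>2 / D\<^sup>2 * l ^ 4"
    unfolding mn1 unfolding D_def by (rule assms(2))
  then have A: "A = (m * n - 1) * l ^ 4"
    using D0 by simp
  have "[:B, A, 0, 0, 0, 1:]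
      = [:- l, 1:] * [:m * l\<^sup>2, v * l, 1:] * [:n * l\<^sup>2, (1 - v) * l, 1:]"
  proof -
    have "B = - l * (m * l\<^sup>2) * (n * l\<^sup>2)"
      unfolding B by algebra
    moreover have "A = m * l\<^sup>2 * (n * l\<^sup>2) - l * (v * l * (n * l\<^sup>2) + (1 - v) * l * (m * l\<^sup>2))"
      unfolding A using 2 by algebra
    moreover have "v * l * (n * l\<^sup>2) + (1 - v) * l * (m * l\<^sup>2)
        - l * (m * l\<^sup>2 + n * l\<^sup>2 + v * l * ((1 - v) * l)) = 0"
      using 1 2 by algebra
    moreover have "m * l\<^sup>2 + n * l\<^sup>2 + v * l * ((1 - v) * l) - l * (v * l + (1 - v) * l) = 0"
      using 1 by algebra
    ultimately show ?thesis
      by (simp add: algebra_simps)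
  qed
  then show ?thesis
    by blast
qed

theorem theorem3p1:
  shows "(\<forall>A B :: rat. A * B \<noteq> 0 \<longrightarrow>
            (has_reducibility_type (trinomial 5 1 A B) [1, 2, 2] \<longleftrightarrow>
              (\<exists>v :: rat. v \<noteq> 0 \<and> v \<noteq> 1 \<and> v \<noteq> 1 / 2 \<and>
                 eq_up_to_scaling 5 1 (A, B)
                   ((v^2 - v - 1) * (v^4 - 2 * v^3 + 4 * v^2 - 3 * v + 1) / (2 * v - 1)^2,
                    - (v * (v - 1) * (v^2 + 1) * (v^2 - 2 * v + 2) / (2 * v - 1)^2))))) \<and>
         \<not> (\<exists>A B :: rat. A * B \<noteq> 0 \<and>
              has_reducibility_type (trinomial 5 1 A B) [1, 1, 1, 2])"
proof (intro conjI allI impI iffI notI)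
  fix A B :: rat
  assume AB: "A * B \<noteq> 0" and type: "has_reducibility_type (trinomial 5 1 A B) [1, 2, 2]"
  from type obtain f g h where fgh: "trinomial 5 1 A B = f * g * h"
    "degree f = 1" "degree g = 2" "degree h = 2"
    unfolding has_reducibility_type_def by (auto simp: map_eq_Cons_conv mult.assoc)
  obtain c1 r where f: "f = smult c1 [:- r, 1:]"
    using degree_1_monic[OF fgh(2)] by blast
  obtain c2 b a where g: "g = smult c2 [:b, a, 1:]"
    using degree_2_monic[OF fgh(3)] by blast
  obtain c3 d e where h: "h = smult c3 [:d, e, 1:]"
    using degree_2_monic[OF fgh(4)] by blast
  have "[:B, A, 0, 0, 0, 1:] = smult (c1 * c2 * c3) ([:- r, 1:] * [:b, a, 1:] * [:d, e, 1:])"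
    using fgh(1) unfolding trinomial_5_1 f g h
    by (simp only: mult_smult_left mult_smult_right smult_smult mult_ac)
  \<comment> \<open>The rational root \<open>r\<close> serves as the scaling factor.\<close>
  from type_122_imp_parametrization[OF this] AB
  show "\<exists>v :: rat. v \<noteq> 0 \<and> v \<noteq> 1 \<and> v \<noteq> 1 / 2 \<and>
                 eq_up_to_scaling 5 1 (A, B)
                   ((v^2 - v - 1) * (v^4 - 2 * v^3 + 4 * v^2 - 3 * v + 1) / (2 * v - 1)^2,
                    - (v * (v - 1) * (v^2 + 1) * (v^2 - 2 * v + 2) / (2 * v - 1)^2))"
    unfolding eq_up_to_scaling_def by fastforce
next
  fix A B :: rat
  assume AB: "A * B \<noteq> 0"
    and "\<exists>v :: rat. v \<noteq> 0 \<and> v \<noteq> 1 \<and> v \<noteq> 1 / 2 \<and>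
                 eq_up_to_scaling 5 1 (A, B)
                   ((v^2 - v - 1) * (v^4 - 2 * v^3 + 4 * v^2 - 3 * v + 1) / (2 * v - 1)^2,
                    - (v * (v - 1) * (v^2 + 1) * (v^2 - 2 * v + 2) / (2 * v - 1)^2))"
  then obtain v l :: rat where vl: "v \<noteq> 1 / 2"
    "A = (v^2 - v - 1) * (v^4 - 2 * v^3 + 4 * v^2 - 3 * v + 1) / (2 * v - 1)^2 * l ^ 4"
    "B = - (v * (v - 1) * (v^2 + 1) * (v^2 - 2 * v + 2) / (2 * v - 1)^2) * l ^ 5"
    unfolding eq_up_to_scaling_def by auto
  then obtain b a d e
    where f: "[:B, A, 0, 0, 0, 1:] = [:- l, 1:] * [:b, a, 1:] * [:d, e, 1:]"
    using parametrization_factors by blast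
  \<comment> \<open>Exchanging the quadratic factors lets \<open>quadratic_factor_no_root\<close>
    apply to the second one as well.\<close>
  then have f': "[:B, A, 0, 0, 0, 1:] = [:- l, 1:] * [:d, e, 1:] * [:b, a, 1:]"
    by (simp only: mult_ac)
  have "irreducible [:b, a, 1:]" "irreducible [:d, e, 1:]"
    using quadratic_factor_no_root[OF f] quadratic_factor_no_root[OF f'] AB
    by (auto intro: irreducible_quadratic)
  moreover have "irreducible [:- l, 1:]"
    by (rule irreducible_linear_field_poly) simp
  moreover have "[:B, A, 0, 0, 0, 1:] = prod_list [[:- l, 1:], [:b, a, 1:], [:d, e, 1:]]"
    by (simp only: f prod_list.Cons prod_list.Nil mult_1_right mult.assoc)
  ultimately show "has_reducibility_type (trinomial 5 1 A B) [1, 2, 2]"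
    unfolding has_reducibility_type_def trinomial_5_1
    by (intro conjI exI[of _ "[[:- l, 1:], [:b, a, 1:], [:d, e, 1:]]"]) simp_all
next
  assume "\<exists>A B :: rat. A * B \<noteq> 0 \<and>
    has_reducibility_type (trinomial 5 1 A B) [1, 1, 1, 2]"
  then obtain A B :: rat where AB: "A * B \<noteq> 0"
    and type: "has_reducibility_type (trinomial 5 1 A B) [1, 1, 1, 2]"
    by blast
  from type obtain f1 f2 f3 g where fg: "trinomial 5 1 A B = f1 * f2 * f3 * g"
    "degree f1 = 1" "degree f2 = 1" "degree f3 = 1" "degree g = 2"
    unfolding has_reducibility_type_def by (auto simp: map_eq_Cons_conv mult.assoc)
  obtain c1 r where f1: "f1 = smult c1 [:- r, 1:]"
    using degree_1_monic[OF fg(2)] by blast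
  obtain c2 s where f2: "f2 = smult c2 [:- s, 1:]"
    using degree_1_monic[OF fg(3)] by blast
  obtain c3 t where f3: "f3 = smult c3 [:- t, 1:]"
    using degree_1_monic[OF fg(4)] by blast
  obtain c4 b a where g: "g = smult c4 [:b, a, 1:]"
    using degree_2_monic[OF fg(5)] by blast
  have "[:B, A, 0, 0, 0, 1:]
      = smult (c1 * c2 * c3 * c4) ([:- r, 1:] * [:- s, 1:] * [:- t, 1:] * [:b, a, 1:])"
    using fg(1) unfolding trinomial_5_1 f1 f2 f3 g
    by (simp only: mult_smult_left mult_smult_right smult_smult mult_ac)
  then have "B = 0"
    by (rule three_rational_roots)
  with AB show False
    by simp
qed

end
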